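(* There exists an absolute constant $c>0$ such that for all integers $N\ge3$ and $g\ge1$, if $A\subseteq\{1^2,2^2,\ldots,N^2\}$ is a $B_2[g]$-set, then $$|A|\ll g^{1/4}N\exp\left(-c\,\frac{\log N}{\log\log N}\right).$$
   Context: For an integer $h\ge2$ and a set $A$ of integers, $R_{A,h}(m)$ is the number of tuples $(a_1,\ldots,a_h)\in A^h$ with $a_1\le a_2\le\cdots\le a_h$ and $a_1+\cdots+a_h=m$. $A$ is a $B_h[g]$-set if $R_{A,h}(m)\le g$ for all integers $m$. $X\ll Y$ means $X\le CY$ for an absolute constant $C>0$. *)

theory Defs
  imports Complex_Main
begin

text \<open>The tuples counted by \<open>R\<^bsub>A,h\<^esub>(m)\<close>, encoded as sorted lists of length \<open>h\<close>.\<close>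

definition sum_reps :: "int set \<Rightarrow> nat \<Rightarrow> int \<Rightarrow> int list set" where
  "sum_reps A h m = {xs. length xs = h \<and> set xs \<subseteq> A \<and> sorted xs \<and> sum_list xs = m}"

definition sum_rep_count :: "int set \<Rightarrow> nat \<Rightarrow> int \<Rightarrow> nat" where
  "sum_rep_count A h m = card (sum_reps A h m)"

text \<open>Since \<open>card\<close> is \<open>0\<close> on infinite sets, finiteness of each set of representations is
  required explicitly: for infinite \<open>A\<close>, an infinite number of representations exceeds \<open>g\<close>.\<close>

definition Bh_set :: "nat \<Rightarrow> nat \<Rightarrow> int set \<Rightarrow> bool" where
  "Bh_set h g A \<longleftrightarrow> (\<forall>m. finite (sum_reps A h m) \<and> sum_rep_count A h m \<le> g)"

end

theory Submission
  imports Defs "HOL-Analysis.Harmonic_Numbers" "HOL-Number_Theory.Number_Theory"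
begin

text \<open>
  Let \<open>X \<subseteq> {1..N}\<close> be the set of square roots of the elements of \<open>A\<close>, and let \<open>P\<close> be a set of \<open>k\<close> primes
  congruent to 1 modulo 4 with product at most \<open>N\<close>. The integers divisible by many \<open>p \<in> P\<close> are rare, but they have
  exceptionally many representations as a sum of two squares: modulo \<open>p\<close> the equation
  \<open>x\<^sup>2 + y\<^sup>2 = 0\<close> has the two lines \<open>y = \<plusminus>r x\<close> of solutions, where \<open>r\<^sup>2 = -1\<close>. The plan is to show that a dense \<open>X\<close>
  realises many of these representations, which contradicts the bound \<open>g\<close>.

  The difficulty is that \<open>X\<close> may avoid the solutions modulo a particular \<open>p\<close> altogether (a set of half
  density in which no \<open>x\<close> occurs together with \<open>\<plusminus>r x\<close>). Therefore no set of primes is imposed in advance: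
  for each \<open>p\<close> the pair \<open>(x, y)\<close> gets the weight \<open>1/2\<close>, plus \<open>p/4\<close> for each line through it, so that
  the product of these weights is an average over all subsets of \<open>P\<close>. At a single prime,
  \<open>correlation_lower_bound\<close> shows that the weighted mean of \<open>f(x) h(y)\<close> is at least the product of the \<open>L\<^sup>1\<^sup>/\<^sup>2\<close>
  quasi-norms of \<open>f\<close> and \<open>h\<close>, a reverse hypercontractive inequality, and \<open>spreading_mult\<close> multiplies such bounds over
  coprime moduli. For an indicator function of density \<open>\<delta>\<close> the quasi-norm is \<open>\<delta>\<^sup>2\<close>, so the pairs in \<open>X\<close>
  have total weight at least of order \<open>\<delta>\<^sup>4 N\<^sup>2\<close> (\<open>weighted_pairs_lower\<close>).

  On the other hand, the weight is bounded by a function of \<open>m = x\<^sup>2 + y\<^sup>2\<close> with mean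
  \<open>\<Prod>(3/4 + 1/(4p)) \<le> (4/5)\<^sup>k\<close>, because a multiple of \<open>p\<close> is credited with one line only while it has two. Since each \<open>m\<close>
  arises from at most \<open>2 g\<close> pairs, the total weight is of order at most \<open>g (4/5)\<^sup>k N\<^sup>2\<close> (\<open>weighted_pairs_upper\<close>).
  Hence \<open>\<delta>\<close> is of order at most \<open>g\<^sup>1\<^sup>/\<^sup>4 (4/5)\<^sup>k\<^sup>/\<^sup>4\<close>.

  It remains to find \<open>k\<close> of order \<open>ln N / ln (ln N)\<close> primes with a square root of \<open>-1\<close> whose product is at most \<open>N\<close>. For
  this a power of \<open>ln N\<close> must exceed sufficiently many of them, and \<open>split_primes_lower_bound\<close> provides such a
  bound by comparing the product of the numbers \<open>n\<^sup>2 + 1\<close> with a squared factorial.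
\<close>

section \<open>Kernels bounded below by square-root means\<close>

text \<open>In the Euclidean space of functions on \<open>S\<close>, with \<open>e\<close> the unit vector in the direction of the
  constants, this says \<open>2 \<langle>a,e\<rangle>\<^sup>2 \<langle>b,e\<rangle>\<^sup>2 \<le> |a|\<^sup>2 |b|\<^sup>2 + \<langle>a,b\<rangle>\<^sup>2\<close>, a form of Buzano's inequality, combined with
  \<open>\<langle>a,b\<rangle>\<^sup>2 \<le> n \<Sum> a\<^sup>2 b\<^sup>2\<close>. If \<open>a\<close> and \<open>b\<close> are square roots of \<open>f\<close> and \<open>h\<close>, the right-hand side averages
  \<open>f(x) h(y)\<close> over independent \<open>x, y\<close> and over \<open>x = y\<close> with equal weights. Equal weights are the
  critical choice: for \<open>a = 1 + \<epsilon> u\<close> and \<open>b = 1 - \<epsilon> u\<close> with \<open>u\<close> of mean zero, any larger weight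
  on the diagonal violates the inequality.\<close>
lemma correlation_lower_bound:
  fixes a b :: "'a \<Rightarrow> real"
  assumes "finite S"
  defines "n \<equiv> real (card S)"
  shows "2 * ((\<Sum>x\<in>S. a x) * (\<Sum>x\<in>S. b x))\<^sup>2
    \<le> n\<^sup>2 * ((\<Sum>x\<in>S. (a x)\<^sup>2) * (\<Sum>x\<in>S. (b x)\<^sup>2) + n * (\<Sum>x\<in>S. (a x)\<^sup>2 * (b x)\<^sup>2))"
proof (cases "S = {}")
  case False
  then have n: "n > 0" using assms by (simp add: card_gt_0_iff)
  define \<alpha> \<beta> where "\<alpha> = (\<Sum>x\<in>S. a x) / n" and "\<beta> = (\<Sum>x\<in>S. b x) / n"
  define A B P where "A = (\<Sum>x\<in>S. (a x)\<^sup>2)" and "B = (\<Sum>x\<in>S. (b x)\<^sup>2)"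
    and "P = (\<Sum>x\<in>S. a x * b x)"
  have sa: "(\<Sum>x\<in>S. a x) = n * \<alpha>" and sb: "(\<Sum>x\<in>S. b x) = n * \<beta>"
    using n by (simp_all add: \<alpha>_def \<beta>_def)
  have "P\<^sup>2 \<le> (\<Sum>x\<in>S. 1\<^sup>2) * (\<Sum>x\<in>S. (a x * b x)\<^sup>2)"
    unfolding P_def using Cauchy_Schwarz_ineq_sum[of "\<lambda>_. 1::real" "\<lambda>x. a x * b x" S] by simp
  then have P: "P\<^sup>2 \<le> n * (\<Sum>x\<in>S. (a x)\<^sup>2 * (b x)\<^sup>2)"
    by (simp add: n_def power_mult_distrib)
  \<comment> \<open>Centre both functions; \<open>U\<close>, \<open>V\<close> and \<open>W\<close> are the variances and the covariance, so \<open>W\<^sup>2 \<le> U V\<close>.\<close>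
  define U V W where "U = A - n * \<alpha>\<^sup>2" and "V = B - n * \<beta>\<^sup>2" and "W = P - n * \<alpha> * \<beta>"
  have U: "(\<Sum>x\<in>S. (a x - \<alpha>)\<^sup>2) = U"
    by (simp add: power2_diff sum.distrib sum_subtractf U_def A_def sa
        flip: sum_distrib_left sum_distrib_right n_def) (simp add: power2_eq_square)
  have V: "(\<Sum>x\<in>S. (b x - \<beta>)\<^sup>2) = V"
    by (simp add: power2_diff sum.distrib sum_subtractf V_def B_def sb
        flip: sum_distrib_left sum_distrib_right n_def) (simp add: power2_eq_square)
  have W: "(\<Sum>x\<in>S. (a x - \<alpha>) * (b x - \<beta>)) = W"
    by (simp add: algebra_simps sum.distrib sum_subtractf W_def P_def sa sb
        flip: sum_distrib_left sum_distrib_right n_def)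
  have UV: "U \<ge> 0" "V \<ge> 0" using U V by (metis sum_nonneg zero_le_power2)+
  have W2: "W\<^sup>2 \<le> U * V"
    using Cauchy_Schwarz_ineq_sum[of "\<lambda>x. a x - \<alpha>" "\<lambda>x. b x - \<beta>" S] by (simp add: U V W)
  have cross: "2 * \<bar>\<alpha> * \<beta> * W\<bar> \<le> U * \<beta>\<^sup>2 + V * \<alpha>\<^sup>2"
  proof -
    have "\<bar>W\<bar> \<le> sqrt U * sqrt V"
      using real_sqrt_le_mono[OF W2] by (simp add: real_sqrt_mult)
    then have "2 * \<bar>\<alpha> * \<beta> * W\<bar> \<le> 2 * (\<bar>\<alpha>\<bar> * \<bar>\<beta>\<bar>) * (sqrt U * sqrt V)"
      by (simp add: abs_mult mult_left_mono)
    also have "\<dots> \<le> (sqrt U * \<bar>\<beta>\<bar>)\<^sup>2 + (sqrt V * \<bar>\<alpha>\<bar>)\<^sup>2"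
      using sum_squares_bound[of "sqrt U * \<bar>\<beta>\<bar>" "sqrt V * \<bar>\<alpha>\<bar>"] by (simp add: mult_ac)
    finally show ?thesis using UV by (simp add: power_mult_distrib)
  qed
  have "A * B + P\<^sup>2 = U * V + W\<^sup>2 + n * (U * \<beta>\<^sup>2 + V * \<alpha>\<^sup>2 + 2 * (\<alpha> * \<beta> * W)) + 2 * (n * \<alpha> * \<beta>)\<^sup>2"
    unfolding U_def V_def W_def by (simp add: algebra_simps power2_eq_square)
  moreover have "n * (U * \<beta>\<^sup>2 + V * \<alpha>\<^sup>2 + 2 * (\<alpha> * \<beta> * W)) \<ge> 0"
    using cross n by (intro mult_nonneg_nonneg) (auto simp: abs_if split: if_splits)
  moreover have "U * V \<ge> 0" using UV by simp
  ultimately have "2 * (n * \<alpha> * \<beta>)\<^sup>2 \<le> A * B + P\<^sup>2"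
    by (smt (verit) zero_le_power2)
  then have "2 * (n * \<alpha> * \<beta>)\<^sup>2 \<le> A * B + n * (\<Sum>x\<in>S. (a x)\<^sup>2 * (b x)\<^sup>2)"
    using P by linarith
  then have "n\<^sup>2 * (2 * (n * \<alpha> * \<beta>)\<^sup>2) \<le> n\<^sup>2 * (A * B + n * (\<Sum>x\<in>S. (a x)\<^sup>2 * (b x)\<^sup>2))"
    by (intro mult_left_mono) auto
  then show ?thesis unfolding sa sb A_def B_def by (simp add: power2_eq_square mult_ac)
qed auto

text \<open>With \<open>a = \<surd>f\<close> and \<open>b = \<surd>h\<close>, the last clause bounds the mean of \<open>f(x) h(y) K(x,y)\<close> from below by
  the product of the \<open>L\<^sup>1\<^sup>/\<^sup>2\<close> quasi-norms of \<open>f\<close> and \<open>h\<close>. Parametrising by square roots makes the property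
  pass to products of kernels without any appeal to Minkowski's inequality.\<close>
definition spreading :: "nat \<Rightarrow> (nat \<Rightarrow> nat \<Rightarrow> real) \<Rightarrow> bool" where
  "spreading n K \<longleftrightarrow> (\<forall>x y. 0 \<le> K x y) \<and> (\<forall>x y. K (x mod n) (y mod n) = K x y) \<and>
     (\<forall>a b. ((\<Sum>x<n. a x) * (\<Sum>y<n. b y))\<^sup>2 \<le> (real n)\<^sup>2 * (\<Sum>x<n. \<Sum>y<n. (a x)\<^sup>2 * (b y)\<^sup>2 * K x y))"

lemma sum_chinese_remainder:
  fixes m n :: nat and H :: "nat \<Rightarrow> nat \<Rightarrow> 'a :: comm_monoid_add"
  assumes "coprime m n" "m > 0" "n > 0"
  shows "(\<Sum>x<m * n. H (x mod m) (x mod n)) = (\<Sum>i<m. \<Sum>j<n. H i j)"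
proof -
  have inj: "inj_on (\<lambda>x. (x mod m, x mod n)) {..<m * n}"
  proof (rule inj_onI)
    fix x y assume "x \<in> {..<m * n}" "y \<in> {..<m * n}" "(x mod m, x mod n) = (y mod m, y mod n)"
    then show "x = y"
      using coprime_cong_mult_nat[of x y m n] assms by (auto simp: cong_def)
  qed
  have "(\<lambda>x. (x mod m, x mod n)) ` {..<m * n} = {..<m} \<times> {..<n}"
    using inj assms by (intro card_subset_eq) (auto simp: card_image)
  then have "(\<Sum>(i,j)\<in>{..<m} \<times> {..<n}. H i j) = (\<Sum>x<m * n. H (x mod m) (x mod n))"
    using sum.reindex[OF inj, of "\<lambda>(i,j). H i j"] by simp
  then show ?thesis by (simp add: sum.cartesian_product)
qed

text \<open>Apply the property of \<open>L\<close> on each pair of fibres over residues modulo \<open>m\<close>, then the property of \<open>K\<close>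
  to the sums of \<open>a\<close> and of \<open>b\<close> over these fibres. The two steps match because the square root of the lower bound
  on a fibre is again a plain sum of values of \<open>a\<close>.\<close>
lemma spreading_mult:
  assumes K: "spreading m K" and L: "spreading n L"
    and mn: "coprime m n" "m > 0" "n > 0"
  shows "spreading (m * n) (\<lambda>x y. K x y * L x y)"
  unfolding spreading_def
proof (intro conjI allI)
  have K0: "0 \<le> K x y" and Kp: "K (x mod m) (y mod m) = K x y"
    and L0: "0 \<le> L x y" and Lp: "L (x mod n) (y mod n) = L x y" for x y
    using K L unfolding spreading_def by auto
  show "0 \<le> K x y * L x y" for x y using K0 L0 by simp
  show "K (x mod (m * n)) (y mod (m * n)) * L (x mod (m * n)) (y mod (m * n)) = K x y * L x y" for x y
    using Kp[of "x mod (m * n)" "y mod (m * n)"] Lp[of "x mod (m * n)" "y mod (m * n)"]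
    by (simp add: mod_mod_cancel Kp Lp)
  fix a b :: "nat \<Rightarrow> real"
  \<comment> \<open>\<open>crt\<close> inverts the residue map on \<open>{..<m * n}\<close>, turning \<open>a\<close> and \<open>b\<close> into functions of two residues.\<close>
  define crt where "crt i j = (THE x. x < m * n \<and> x mod m = i \<and> x mod n = j)" for i j
  have crt: "crt (x mod m) (x mod n) = x" if "x < m * n" for x
    unfolding crt_def
  proof (rule the_equality)
    show "y = x" if "y < m * n \<and> y mod m = x mod m \<and> y mod n = x mod n" for y
      using coprime_cong_mult_nat[of y x m n] mn that \<open>x < m * n\<close> by (auto simp: cong_def)
  qed (use that in simp)
  define a' b' where "a' i j = a (crt i j)" and "b' i j = b (crt i j)" for i j
  have split: "(\<Sum>x<m * n. F x) = (\<Sum>i<m. \<Sum>j<n. F (crt i j))" for F :: "nat \<Rightarrow> real"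
    using sum_chinese_remainder[OF mn, of "\<lambda>i j. F (crt i j)"] by (simp add: crt)
  have "(\<Sum>x<m * n. \<Sum>y<m * n. (a x)\<^sup>2 * (b y)\<^sup>2 * (K x y * L x y))
      = (\<Sum>x<m * n. \<Sum>y<m * n. (a' (x mod m) (x mod n))\<^sup>2 * (b' (y mod m) (y mod n))\<^sup>2
          * (K (x mod m) (y mod m) * L (x mod n) (y mod n)))"
    by (simp add: a'_def b'_def crt Kp Lp)
  also have "\<dots> = (\<Sum>i<m. \<Sum>j<n. \<Sum>i'<m. \<Sum>j'<n. (a' i j)\<^sup>2 * (b' i' j')\<^sup>2 * (K i i' * L j j'))"
    by (subst sum_chinese_remainder[OF mn, of "\<lambda>i' j'. (a' _ _)\<^sup>2 * (b' i' j')\<^sup>2 * (K _ i' * L _ j')"])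
       (rule sum_chinese_remainder[OF mn, of "\<lambda>i j. \<Sum>i'<m. \<Sum>j'<n. (a' i j)\<^sup>2 * (b' i' j')\<^sup>2 * (K i i' * L j j')"])
  also have "\<dots> = (\<Sum>i<m. \<Sum>i'<m. (\<Sum>j<n. \<Sum>j'<n. (a' i j)\<^sup>2 * (b' i' j')\<^sup>2 * L j j') * K i i')"
    by (subst sum.swap[of _ "{..<m}" "{..<n}"]) (simp add: sum_distrib_left sum_distrib_right mult_ac)
  finally have eq: "(\<Sum>x<m * n. \<Sum>y<m * n. (a x)\<^sup>2 * (b y)\<^sup>2 * (K x y * L x y))
      = (\<Sum>i<m. \<Sum>i'<m. (\<Sum>j<n. \<Sum>j'<n. (a' i j)\<^sup>2 * (b' i' j')\<^sup>2 * L j j') * K i i')" .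
  have "((\<Sum>x<m * n. a x) * (\<Sum>y<m * n. b y))\<^sup>2
      = ((\<Sum>i<m. \<Sum>j<n. a' i j) * (\<Sum>i<m. \<Sum>j<n. b' i j))\<^sup>2"
    by (simp add: split a'_def b'_def)
  also have "\<dots> \<le> (real m)\<^sup>2 * (\<Sum>i<m. \<Sum>i'<m. (\<Sum>j<n. a' i j)\<^sup>2 * (\<Sum>j<n. b' i' j)\<^sup>2 * K i i')"
    using K unfolding spreading_def by blast
  also have "\<dots> \<le> (real m)\<^sup>2 * (\<Sum>i<m. \<Sum>i'<m.
      ((real n)\<^sup>2 * (\<Sum>j<n. \<Sum>j'<n. (a' i j)\<^sup>2 * (b' i' j')\<^sup>2 * L j j')) * K i i')"
    using L K0 unfolding spreading_def
    by (intro mult_left_mono sum_mono mult_right_mono) (auto simp flip: power_mult_distrib)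
  also have "\<dots> = (real (m * n))\<^sup>2 * (\<Sum>x<m * n. \<Sum>y<m * n. (a x)\<^sup>2 * (b y)\<^sup>2 * (K x y * L x y))"
    unfolding eq by (simp add: sum_distrib_left power_mult_distrib mult_ac)
  finally show "((\<Sum>x<m * n. a x) * (\<Sum>y<m * n. b y))\<^sup>2
     \<le> (real (m * n))\<^sup>2 * (\<Sum>x<m * n. \<Sum>y<m * n. (a x)\<^sup>2 * (b y)\<^sup>2 * (K x y * L x y))" .
qed

section \<open>Local kernels and weights for sums of two squares\<close>

text \<open>These are the primes congruent to 1 modulo 4.\<close>
definition split_prime :: "nat \<Rightarrow> bool" where
  "split_prime p \<longleftrightarrow> prime p \<and> odd p \<and> (\<exists>r. p dvd r\<^sup>2 + 1)"

text \<open>Half of the weight is uniform, and half sits on the isotropic pairs \<open>x\<^sup>2 + y\<^sup>2 \<equiv> 0 (mod p)\<close>, that is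
  on the two lines \<open>y \<equiv> \<plusminus>r x\<close> with \<open>r\<^sup>2 \<equiv> -1\<close>. The origin lies on both lines, hence the second indicator.\<close>
definition local_kernel :: "nat \<Rightarrow> nat \<Rightarrow> nat \<Rightarrow> real" where
  "local_kernel p x y = 1/2 + real p / 4 * (of_bool (p dvd x\<^sup>2 + y\<^sup>2) + of_bool (p dvd x \<and> p dvd y))"

text \<open>This depends on \<open>x\<^sup>2 + y\<^sup>2\<close> only, and it dominates the kernel because \<open>p\<close> dividing both \<open>x\<close> and \<open>y\<close> makes \<open>p\<^sup>2\<close> divide
  \<open>x\<^sup>2 + y\<^sup>2\<close>. The kernel has mean 1 over pairs of residues, but the weight has mean \<open>3/4 + 1/(4p)\<close>
  over integers: a typical multiple of \<open>p\<close> has two lines of representations. This loss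
  of mass, multiplied over many primes, is the whole gain of the argument.\<close>
definition local_weight :: "nat \<Rightarrow> nat \<Rightarrow> real" where
  "local_weight p m = 1/2 + real p / 4 * (of_bool (p dvd m) + of_bool (p\<^sup>2 dvd m))"

lemma local_kernel_le_weight: "local_kernel p x y \<le> local_weight p (x\<^sup>2 + y\<^sup>2)"
proof -
  have "p\<^sup>2 dvd x\<^sup>2 + y\<^sup>2" if "p dvd x" "p dvd y"
    using that by (intro dvd_add dvd_power_same)
  then show ?thesis
    unfolding local_kernel_def local_weight_def by (auto intro!: mult_left_mono)
qed

text \<open>The kernel dominates the average, over the two permutations \<open>x \<mapsto> \<plusminus>r x\<close> of the residues, of the kernels
  with weights \<open>1/2\<close> on independent pairs and \<open>1/2\<close> on the graph of the permutation. After
  relabelling \<open>b\<close> by the permutation, each of these is an instance of the correlation inequality.\<close>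
lemma spreading_local_kernel:
  assumes "split_prime p"
  shows "spreading p (local_kernel p)"
proof -
  from assms obtain r where p: "prime p" "odd p" and r: "p dvd r\<^sup>2 + 1"
    unfolding split_prime_def by blast
  have p2: "p > 2" using p prime_ge_2_nat[of p] by (metis even_numeral le_neq_implies_less)
  have cop: "coprime r p"
  proof (rule ccontr)
    assume "\<not> coprime r p"
    then have "p dvd r" using p(1) by (metis coprime_commute prime_imp_coprime)
    then have "p dvd r\<^sup>2" by (simp add: power2_eq_square)
    then have "p dvd 1" using r dvd_add_right_iff by blast
    then show False using p2 by simp
  qed
  define \<sigma> where "\<sigma> s x = (s * x) mod p" for s x
  have bij: "bij_betw (\<sigma> s) {..<p} {..<p}" if "coprime s p" for s
  proof -
    have "inj_on (\<sigma> s) {..<p}"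
    proof (rule inj_onI)
      fix x y assume xy: "x \<in> {..<p}" "y \<in> {..<p}" "\<sigma> s x = \<sigma> s y"
      then have "[s * x = s * y] (mod p)" by (simp add: \<sigma>_def cong_def)
      then have "[x = y] (mod p)" using that cong_mult_lcancel_nat by blast
      then show "x = y" using xy by (simp add: cong_def)
    qed
    moreover have "\<sigma> s ` {..<p} \<subseteq> {..<p}" using p2 by (auto simp: \<sigma>_def)
    ultimately show ?thesis
      by (simp add: bij_betw_def endo_inj_surj)
  qed
  \<comment> \<open>\<open>(p - 1) r\<close> represents \<open>-r\<close> among the natural numbers.\<close>
  define r' where "r' = (p - 1) * r"
  have cop': "coprime r' p"
    unfolding r'_def using cop p2 coprime_diff_one_left_nat[of p] by simp
  have r': "p dvd r + r'"
  proof -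
    have "r + r' = p * r" unfolding r'_def using p2 by (cases p) auto
    then show ?thesis by simp
  qed
  have r'2: "p dvd r'\<^sup>2 + 1"
  proof -
    have "[int r' = - int r] (mod int p)"
      using r' by (metis cong_iff_dvd_diff diff_minus_eq_add add.commute int_dvd_int_iff of_nat_add)
    then have "[int r' ^ 2 + 1 = (- int r) ^ 2 + 1] (mod int p)"
      by (intro cong_add cong_pow) auto
    moreover have "int p dvd (- int r) ^ 2 + 1"
      using r by (metis int_dvd_int_iff of_nat_1 of_nat_add of_nat_power power2_minus)
    ultimately have "int p dvd int r' ^ 2 + 1"
      using cong_dvd_iff by blast
    then show ?thesis
      by (metis int_dvd_int_iff of_nat_1 of_nat_add of_nat_power)
  qed
  have root: "p dvd x\<^sup>2 + (\<sigma> s x)\<^sup>2" if "p dvd s\<^sup>2 + 1" for s x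
  proof -
    have "[x\<^sup>2 + (\<sigma> s x)\<^sup>2 = x\<^sup>2 + (s * x)\<^sup>2] (mod p)"
      unfolding \<sigma>_def by (intro cong_add cong_pow) (auto simp: cong_def)
    moreover have "x\<^sup>2 + (s * x)\<^sup>2 = (s\<^sup>2 + 1) * x\<^sup>2"
      by (simp add: power_mult_distrib algebra_simps)
    ultimately show ?thesis using that by (metis cong_dvd_iff dvd_mult2)
  qed
  have couple: "1/2 + real p / 4 * (of_bool (y = \<sigma> r x) + of_bool (y = \<sigma> r' x)) \<le> local_kernel p x y"
    if "x < p" for x y
  proof -
    \<comment> \<open>The two lines meet only at the origin, where \<open>local_kernel\<close> counts twice.\<close>
    have "x = 0" if "\<sigma> r x = \<sigma> r' x"
    proof -
      have "[r * x = r' * x] (mod p)" using that by (simp add: \<sigma>_def cong_def)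
      then have "[r * x + r * x = r * x + r' * x] (mod p)" by (intro cong_add) auto
      then have "p dvd 2 * (r * x)"
        using r' by (metis cong_dvd_iff distrib_right dvd_mult2 mult_2)
      then have "p dvd x"
        using p p2 cop by (metis coprime_commute coprime_dvd_mult_right_iff nat_dvd_not_less prime_dvd_mult_iff zero_less_numeral)
      then show "x = 0" using \<open>x < p\<close> by (cases "x = 0") (auto dest: dvd_imp_le)
    qed
    moreover have "y = \<sigma> r x \<Longrightarrow> p dvd x\<^sup>2 + y\<^sup>2" "y = \<sigma> r' x \<Longrightarrow> p dvd x\<^sup>2 + y\<^sup>2"
      using root r r'2 by auto
    moreover have "\<sigma> s 0 = 0" for s by (simp add: \<sigma>_def)
    ultimately have "of_bool (y = \<sigma> r x) + of_bool (y = \<sigma> r' x)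
        \<le> (of_bool (p dvd x\<^sup>2 + y\<^sup>2) + of_bool (p dvd x \<and> p dvd y) :: real)"
      by auto
    then show ?thesis unfolding local_kernel_def by (simp add: mult_left_mono)
  qed
  show ?thesis
    unfolding spreading_def
  proof (intro conjI allI)
    show "0 \<le> local_kernel p x y" for x y by (simp add: local_kernel_def)
    have "p dvd (x mod p)\<^sup>2 + (y mod p)\<^sup>2 \<longleftrightarrow> p dvd x\<^sup>2 + y\<^sup>2" for x y
      by (intro cong_dvd_iff cong_add cong_pow) (auto simp: cong_def)
    then show "local_kernel p (x mod p) (y mod p) = local_kernel p x y" for x y
      by (simp add: local_kernel_def dvd_mod_iff)
    fix a b :: "nat \<Rightarrow> real"
    define A B where "A = (\<Sum>x<p. (a x)\<^sup>2)" and "B = (\<Sum>x<p. (b x)\<^sup>2)"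
    define G where "G s = (\<Sum>x<p. (a x)\<^sup>2 * (b (\<sigma> s x))\<^sup>2)" for s
    have ineq: "2 * ((\<Sum>x<p. a x) * (\<Sum>x<p. b x))\<^sup>2 \<le> (real p)\<^sup>2 * (A * B + p * G s)"
      if "coprime s p" for s
    proof -
      have "(\<Sum>x<p. b (\<sigma> s x)) = (\<Sum>x<p. b x)" "(\<Sum>x<p. (b (\<sigma> s x))\<^sup>2) = B"
        unfolding B_def by (rule sum.reindex_bij_betw[OF bij[OF that]])+
      then show ?thesis
        using correlation_lower_bound[of "{..<p}" a "\<lambda>x. b (\<sigma> s x)"] by (simp add: A_def G_def)
    qed
    have G: "(\<Sum>x<p. \<Sum>y<p. (a x)\<^sup>2 * (b y)\<^sup>2 * of_bool (y = \<sigma> s x)) = G s" for s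
    proof -
      have "\<sigma> s x < p" for x using p2 by (simp add: \<sigma>_def)
      then show ?thesis
        unfolding G_def by (intro sum.cong refl) (simp add: of_bool_def if_distrib[of "(*) _"] cong: if_cong)
    qed
    have AB: "A * B = (\<Sum>x<p. \<Sum>y<p. (a x)\<^sup>2 * (b y)\<^sup>2)"
      by (simp add: A_def B_def sum_product)
    have "((\<Sum>x<p. a x) * (\<Sum>y<p. b y))\<^sup>2
        \<le> ((real p)\<^sup>2 * (A * B + p * G r) + (real p)\<^sup>2 * (A * B + p * G r')) / 4"
    proof -
      have "s \<le> (u + v) / 4" if "2 * s \<le> u" "2 * s \<le> v" for s u v :: real
        using that by simp
      then show ?thesis using ineq[OF cop] ineq[OF cop'] by blast
    qed
    also have "\<dots> = (real p)\<^sup>2 * (A * B / 2 + p / 4 * (G r + G r'))"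
      by (simp add: field_simps)
    also have "A * B / 2 + p / 4 * (G r + G r') = (\<Sum>x<p. \<Sum>y<p. (a x)\<^sup>2 * (b y)\<^sup>2 *
        (1/2 + real p / 4 * (of_bool (y = \<sigma> r x) + of_bool (y = \<sigma> r' x))))"
      unfolding AB G[symmetric]
      by (simp add: sum_distrib_left sum_divide_distrib distrib_left sum.distrib mult_ac)
    also have "\<dots> \<le> (\<Sum>x<p. \<Sum>y<p. (a x)\<^sup>2 * (b y)\<^sup>2 * local_kernel p x y)"
      by (intro sum_mono mult_left_mono couple) auto
    finally show "((\<Sum>x<p. a x) * (\<Sum>y<p. b y))\<^sup>2
        \<le> (real p)\<^sup>2 * (\<Sum>x<p. \<Sum>y<p. (a x)\<^sup>2 * (b y)\<^sup>2 * local_kernel p x y)"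
      by (simp add: mult_left_mono)
  qed
qed

lemma coprime_prod_primes:
  fixes p :: nat
  assumes "prime p" "\<And>q. q \<in> P \<Longrightarrow> prime q" "p \<notin> P"
  shows "coprime p (\<Prod>P)"
  using assms by (intro prod_coprime_right) (metis primes_coprime)

lemma spreading_prod_kernel:
  assumes "finite P" "\<And>p. p \<in> P \<Longrightarrow> split_prime p"
  shows "spreading (\<Prod>P) (\<lambda>x y. \<Prod>p\<in>P. local_kernel p x y)"
  using assms
proof (induction P rule: finite_induct)
  case empty
  show ?case by (simp add: spreading_def power_mult_distrib)
next
  case (insert p P)
  have pr: "prime q" if "q \<in> insert p P" for q
    using insert.prems[OF that] by (simp add: split_prime_def)
  then have "coprime p (\<Prod>P)" "p > 0" "\<Prod>P > 0"
    using insert.hyps coprime_prod_primes[of p P] by (auto intro!: prod_pos prime_gt_0_nat)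
  then show ?case
    using spreading_mult[OF spreading_local_kernel[of p] insert.IH] insert by simp
qed

lemma sum_local_weight:
  assumes "p > 0"
  shows "(\<Sum>m<p\<^sup>2. local_weight p m) = (real p)\<^sup>2 * (3/4 + 1 / (4 * real p))"
proof -
  have "{..<p\<^sup>2} \<inter> {m. p dvd m} = (*) p ` {..<p}"
    using assms by (auto simp: power2_eq_square elim!: dvdE)
  then have "card ({..<p\<^sup>2} \<inter> {m. p dvd m}) = p"
    using assms by (simp add: card_image inj_on_def)
  then have 1: "(\<Sum>m<p\<^sup>2. of_bool (p dvd m) :: real) = p"
    by (simp add: of_bool_def sum.If_cases)
  have "{..<p\<^sup>2} \<inter> {m. p\<^sup>2 dvd m} = {0}"
    using assms by (auto dest: dvd_imp_le)
  then have 2: "(\<Sum>m<p\<^sup>2. of_bool (p\<^sup>2 dvd m) :: real) = 1"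
    by (simp add: of_bool_def sum.If_cases)
  show ?thesis
    unfolding local_weight_def sum.distrib sum_distrib_left[symmetric] 1 2
    using assms by (simp add: field_simps power2_eq_square)
qed

lemma local_weight_nonneg: "0 \<le> local_weight p m"
  by (simp add: local_weight_def)

lemma local_weight_mod: 
  assumes "p\<^sup>2 dvd q"
  shows "local_weight p (m mod q) = local_weight p m"
  using assms by (simp add: local_weight_def dvd_mod_iff dvd_trans[of p "p\<^sup>2" q])

lemma sum_prod_weight_le:
  assumes "finite P" "\<And>p. p \<in> P \<Longrightarrow> split_prime p"
  shows "(\<Sum>m<(\<Prod>P)\<^sup>2. \<Prod>p\<in>P. local_weight p m) \<le> (real (\<Prod>P))\<^sup>2 * (4/5) ^ card P"
  using assms
proof (induction P rule: finite_induct)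
  case (insert p P)
  have pr: "prime q" if "q \<in> insert p P" for q
    using insert.prems[OF that] by (simp add: split_prime_def)
  have p: "p > 0" "coprime (p\<^sup>2) ((\<Prod>P)\<^sup>2)" "(\<Prod>P)\<^sup>2 > 0"
    using pr insert.hyps coprime_prod_primes[of p P] by (auto intro!: prod_pos prime_gt_0_nat)
  \<comment> \<open>Below 5, the only odd prime is 3, and \<open>-1\<close> is not a square modulo 3; \<open>p \<ge> 5\<close> gives mean weight at most \<open>4/5\<close>.\<close>
  have p5: "p \<ge> 5"
  proof (rule ccontr)
    assume "\<not> p \<ge> 5"
    moreover have "prime p" "odd p" using insert.prems[of p] by (auto simp: split_prime_def)
    ultimately have "p = 3" 
      using prime_ge_2_nat[of p] by (cases "p = 2"; cases "p = 4"; auto)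
    obtain r :: nat where "3 dvd r\<^sup>2 + 1"
      using insert.prems[of p] \<open>p = 3\<close> by (auto simp: split_prime_def)
    then have "((r mod 3)\<^sup>2 + 1) mod 3 = 0"
      by (metis dvd_imp_mod_0 mod_add_left_eq power_mod)
    moreover have "r mod 3 < 3" by simp
    then have "r mod 3 = 0 \<or> r mod 3 = 1 \<or> r mod 3 = 2" by linarith
    ultimately show False by (elim disjE) simp_all
  qed
  have dv: "q\<^sup>2 dvd (\<Prod>P)\<^sup>2" if "q \<in> P" for q
    using that insert.hyps by (intro dvd_power_same dvd_prodI[where f="\<lambda>x. x", simplified]) auto
  have mod: "(\<Prod>q\<in>P. local_weight q (m mod (\<Prod>P)\<^sup>2)) = (\<Prod>q\<in>P. local_weight q m)" for m
    by (intro prod.cong refl local_weight_mod dv)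
  have "(\<Sum>m<(\<Prod>(insert p P))\<^sup>2. \<Prod>q\<in>insert p P. local_weight q m)
      = (\<Sum>m<p\<^sup>2 * (\<Prod>P)\<^sup>2. local_weight p (m mod p\<^sup>2) * (\<Prod>q\<in>P. local_weight q (m mod (\<Prod>P)\<^sup>2)))"
    using insert.hyps by (simp add: local_weight_mod mod power_mult_distrib)
  also have "\<dots> = (\<Sum>m<p\<^sup>2. local_weight p m) * (\<Sum>m<(\<Prod>P)\<^sup>2. \<Prod>q\<in>P. local_weight q m)"
    using p by (subst sum_chinese_remainder[of _ _ "\<lambda>i j. local_weight p i * (\<Prod>q\<in>P. local_weight q j)"])
      (auto simp: sum_product)
  also have "\<dots> \<le> ((real p)\<^sup>2 * (4/5)) * ((real (\<Prod>P))\<^sup>2 * (4/5) ^ card P)"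
  proof (intro mult_mono)
    have "3/4 + 1 / (4 * real p) \<le> 4/5" using p5 by (simp add: field_simps)
    then show "(\<Sum>m<p\<^sup>2. local_weight p m) \<le> (real p)\<^sup>2 * (4/5)"
      unfolding sum_local_weight[OF p(1)] by (intro mult_left_mono) auto
    show "0 \<le> (\<Sum>m<(\<Prod>P)\<^sup>2. \<Prod>q\<in>P. local_weight q m)"
      by (intro sum_nonneg prod_nonneg) (auto simp: local_weight_nonneg)
  qed (use insert in auto)
  also have "\<dots> = (real (\<Prod>(insert p P)))\<^sup>2 * (4/5) ^ card (insert p P)"
    using insert.hyps by (simp add: power_mult_distrib)
  finally show ?case .
qed simp

section \<open>A lower bound for the number of primes with a square root of minus one\<close>

lemma multiplicity_eq_card:
  fixes p x :: nat
  assumes "prime p" "x > 0" "\<And>j. p ^ j dvd x \<Longrightarrow> j \<le> J"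
  shows "multiplicity p x = card {j\<in>{1..J}. p ^ j dvd x}"
proof -
  have iff: "p ^ j dvd x \<longleftrightarrow> j \<le> multiplicity p x" for j
    using assms by (intro power_dvd_iff_le_multiplicity) auto
  have "multiplicity p x \<le> J"
    using assms(3) multiplicity_dvd by blast
  then have "{j\<in>{1..J}. p ^ j dvd x} = {1..multiplicity p x}"
    unfolding iff by auto
  then show ?thesis by simp
qed

lemma multiplicity_prod_eq_sum_card:
  fixes f :: "nat \<Rightarrow> nat"
  assumes "prime p" "finite S" "\<And>n. n \<in> S \<Longrightarrow> f n > 0" "\<And>n j. n \<in> S \<Longrightarrow> p ^ j dvd f n \<Longrightarrow> j \<le> J"
  shows "multiplicity p (\<Prod>n\<in>S. f n) = (\<Sum>j=1..J. card {n\<in>S. p ^ j dvd f n})"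
proof -
  have "multiplicity p (\<Prod>n\<in>S. f n) = (\<Sum>n\<in>S. multiplicity p (f n))"
    using assms by (intro prime_elem_multiplicity_prod_distrib) (auto simp: image_iff)
  also have "\<dots> = (\<Sum>n\<in>S. card {j\<in>{1..J}. p ^ j dvd f n})"
    using assms by (intro sum.cong refl multiplicity_eq_card) auto
  also have "\<dots> = (\<Sum>j=1..J. card {n\<in>S. p ^ j dvd f n})"
    using assms(2) sum_multicount_gen[of S "{1..J}" "\<lambda>n j. p ^ j dvd f n" "\<lambda>j. card {n\<in>S. p ^ j dvd f n}"] by auto
  finally show ?thesis .
qed

lemma card_cong_class_le:
  fixes q X c :: nat
  assumes "q > 0"
  shows "card {n\<in>{1..X}. n mod q = c} \<le> X div q + 1"
proof -
  have "inj_on (\<lambda>n. n div q) {n\<in>{1..X}. n mod q = c}"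
    by (rule inj_onI) (metis (mono_tags, lifting) div_mult_mod_eq mem_Collect_eq)
  moreover have "(\<lambda>n. n div q) ` {n\<in>{1..X}. n mod q = c} \<subseteq> {0..X div q}"
    by (auto simp: div_le_mono)
  ultimately have "card {n\<in>{1..X}. n mod q = c} \<le> card {0..X div q}"
    by (metis card_inj_on_le finite_atLeastAtMost)
  then show ?thesis by simp
qed

text \<open>Modulo an odd prime power there are at most two square roots of \<open>-1\<close>: if \<open>a\<close> is one and \<open>n\<close> another,
  \<open>p\<^sup>j\<close> divides \<open>(n - a)(n + a)\<close>, and \<open>p\<close> cannot divide both factors since it would then divide \<open>a\<close>.\<close>
lemma card_roots_of_minus_one_le:
  fixes p j X :: nat
  assumes "prime p" "odd p"
  shows "card {n\<in>{1..X}. p ^ j dvd n\<^sup>2 + 1} \<le> 2 * (X div p ^ j + 1)"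
proof (cases "{n\<in>{1..X}. p ^ j dvd n\<^sup>2 + 1} = {}")
  case False
  define q where "q = p ^ j"
  have q: "q > 0" using assms by (simp add: q_def prime_gt_0_nat)
  from False obtain a where a: "q dvd a\<^sup>2 + 1" by (auto simp: q_def)
  have sub: "n mod q = a mod q \<or> n mod q = (q - a mod q) mod q" if n: "q dvd n\<^sup>2 + 1" for n
  proof (cases "j = 0")
    case True
    then show ?thesis by (simp add: q_def)
  next
    case False
    define x y where "x = int n - int a" and "y = int n + int a"
    have "int q dvd (int n ^ 2 + 1) - (int a ^ 2 + 1)"
      using a n by (intro dvd_diff) (metis int_dvd_int_iff of_nat_1 of_nat_add of_nat_power)+
    then have xy: "int p ^ j dvd x * y"
      by (simp add: x_def y_def q_def algebra_simps power2_eq_square)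
    have pp: "prime (int p)" using assms by simp
    have "\<not> (int p dvd x \<and> int p dvd y)"
    proof
      assume "int p dvd x \<and> int p dvd y"
      then have "int p dvd 2 * int a" 
        using dvd_diff[of "int p" y x] by (simp add: x_def y_def)
      then have "p dvd 2 * a" by (metis int_dvd_int_iff of_nat_mult of_nat_numeral)
      then have "p dvd a"
        using assms prime_dvd_multD[of p 2 a] primes_dvd_imp_eq[of p 2] by auto
      moreover have "p dvd a\<^sup>2 + 1" using a False by (metis q_def dvd_power dvd_trans gr0I)
      ultimately have "p dvd 1" using dvd_add_right_iff[of p "a\<^sup>2" 1] by (simp add: power2_eq_square)
      then show False using assms(1) by simp
    qed
    then have "int p ^ j dvd x \<or> int p ^ j dvd y"
      using xy pp prime_imp_coprime[of "int p"]
      by (meson coprime_dvd_mult_left_iff coprime_dvd_mult_right_iff coprime_power_left_iff)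
    then show ?thesis
    proof
      assume "int p ^ j dvd x"
      then have "[int n = int a] (mod int q)" by (simp add: cong_iff_dvd_diff x_def q_def)
      then show ?thesis using cong_int_iff by (auto simp: cong_def)
    next
      assume "int p ^ j dvd y"
      then have "q dvd n + a" by (metis int_dvd_int_iff of_nat_add of_nat_power q_def y_def)
      then have "q dvd n + a mod q" by (metis dvd_eq_mod_eq_0 mod_add_right_eq)
      moreover have "q dvd (q - a mod q) + a mod q" using q by (simp add: less_imp_le_nat)
      ultimately have "[n + a mod q = (q - a mod q) + a mod q] (mod q)"
        by (metis cong_0_iff cong_sym cong_trans)
      then have "[n = q - a mod q] (mod q)" using cong_add_rcancel_nat by blast
      then show ?thesis by (simp add: cong_def)
    qed
  qed
  have "card {n\<in>{1..X}. q dvd n\<^sup>2 + 1}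
      \<le> card ({n\<in>{1..X}. n mod q = a mod q} \<union> {n\<in>{1..X}. n mod q = (q - a mod q) mod q})"
    using sub by (intro card_mono) auto
  also have "\<dots> \<le> (X div q + 1) + (X div q + 1)"
    by (intro order.trans[OF card_Un_le] add_mono card_cong_class_le q)
  finally show ?thesis by (simp add: q_def)
next
  case True
  show ?thesis unfolding True by simp
qed

lemma multiplicity_fact_ge:
  fixes p :: nat
  assumes "prime p"
  shows "(\<Sum>j=1..J. X div p ^ j) \<le> multiplicity p (fact X)"
proof -
  have p: "p \<ge> 2" using assms prime_ge_2_nat by blast
  have bd: "j \<le> max J X" if "n \<in> {1..X}" "p ^ j dvd n" for n j
  proof -
    \<comment> \<open>Any exponent \<open>j\<close> with \<open>p\<^sup>j \<le> X\<close> is at most \<open>X\<close>, a crude cutoff for Legendre's formula.\<close>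
    have "j < 2 ^ j" by (rule less_exp)
    also have "2 ^ j \<le> p ^ j" using p by (intro power_mono) auto
    also have "p ^ j \<le> n" using that by (intro dvd_imp_le) auto
    finally show ?thesis using that by auto
  qed
  have "multiplicity p (fact X) = (\<Sum>j=1..max J X. card {n\<in>{1..X}. p ^ j dvd n})"
    unfolding fact_prod of_nat_id
    using multiplicity_prod_eq_sum_card[of p "{1..X}" "\<lambda>n. n" "max J X"] assms bd by auto
  moreover have "card {n\<in>{1..X}. q dvd n} = X div q" if "q > 0" for q
  proof -
    have "{n\<in>{1..X}. q dvd n} = (*) q ` {1..X div q}"
      using that by (auto simp: less_eq_div_iff_mult_less_eq mult.commute elim!: dvdE)
    then show ?thesis using that by (simp add: card_image inj_on_def)
  qed
  ultimately have "multiplicity p (fact X) = (\<Sum>j=1..max J X. X div p ^ j)"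
    using p by simp
  also have "\<dots> \<ge> (\<Sum>j=1..J. X div p ^ j)" by (intro sum_mono2) auto
  finally show ?thesis .
qed

text \<open>By the two-roots bound, the number of \<open>n \<le> X\<close> with \<open>p\<^sup>j\<close> dividing \<open>n\<^sup>2 + 1\<close> is at most twice the number of
  multiples of \<open>p\<^sup>j\<close> up to \<open>X\<close>, plus 2. The extra terms occur for the \<open>J\<close> exponents with \<open>p\<^sup>j \<le> X\<^sup>2 + 1\<close> and
  so contribute a factor of at most \<open>(X\<^sup>2 + 1)\<^sup>2\<close>.\<close>
lemma power_multiplicity_le:
  fixes p X :: nat
  assumes "prime p" "odd p"
  shows "p ^ multiplicity p (\<Prod>n=1..X. n\<^sup>2 + 1) \<le> (p ^ multiplicity p (fact X))\<^sup>2 * (X\<^sup>2 + 1)\<^sup>2"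
proof -
  have p: "p \<ge> 2" using assms prime_ge_2_nat by blast
  obtain J where J: "p ^ J \<le> X\<^sup>2 + 1" "X\<^sup>2 + 1 < p ^ (J + 1)"
    using ex_power_ivl1[of p "X\<^sup>2 + 1"] p by auto
  have bd: "j \<le> J" if "n \<in> {1..X}" "p ^ j dvd n\<^sup>2 + 1" for n j
  proof -
    have "p ^ j \<le> n\<^sup>2 + 1" using that by (intro dvd_imp_le) auto
    also have "\<dots> \<le> X\<^sup>2 + 1" using that by (simp add: power_mono)
    also have "\<dots> < p ^ (J + 1)" by (rule J)
    finally show ?thesis using p power_less_imp_less_exp[of p j "J + 1"] by simp
  qed
  have "multiplicity p (\<Prod>n=1..X. n\<^sup>2 + 1) = (\<Sum>j=1..J. card {n\<in>{1..X}. p ^ j dvd n\<^sup>2 + 1})"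
    using assms bd by (intro multiplicity_prod_eq_sum_card) auto
  also have "\<dots> \<le> (\<Sum>j=1..J. 2 * (X div p ^ j + 1))"
    by (intro sum_mono card_roots_of_minus_one_le assms)
  also have "\<dots> = 2 * (\<Sum>j=1..J. X div p ^ j) + 2 * J"
    by (simp only: distrib_left sum.distrib sum_distrib_left) simp
  also have "\<dots> \<le> 2 * multiplicity p (fact X) + 2 * J"
    using multiplicity_fact_ge[OF assms(1)] by simp
  finally have "p ^ multiplicity p (\<Prod>n=1..X. n\<^sup>2 + 1) \<le> p ^ (2 * multiplicity p (fact X) + 2 * J)"
    using p by (intro power_increasing) auto
  also have "\<dots> = (p ^ multiplicity p (fact X))\<^sup>2 * (p ^ J)\<^sup>2"
    by (simp add: power_add power_mult mult.commute[of 2])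
  also have "\<dots> \<le> (p ^ multiplicity p (fact X))\<^sup>2 * (X\<^sup>2 + 1)\<^sup>2"
    using J by (intro mult_left_mono power_mono) auto
  finally show ?thesis .
qed

lemma prod_power_multiplicity_dvd:
  fixes n :: nat
  assumes "finite S" "\<And>p. p \<in> S \<Longrightarrow> prime p" "n > 0"
  shows "(\<Prod>p\<in>S. p ^ multiplicity p n) dvd n"
proof -
  have "(\<Prod>p\<in>S. p ^ multiplicity p n) = (\<Prod>p\<in>S \<inter> prime_factors n. p ^ multiplicity p n)"
    using assms by (intro prod.mono_neutral_right) (auto simp: prime_factors_multiplicity)
  also have "\<dots> dvd (\<Prod>p\<in>prime_factors n. p ^ multiplicity p n)"
    by (intro prod_dvd_prod_subset) auto
  also have "\<dots> = n" using assms by (simp add: prod_prime_factors)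
  finally show ?thesis .
qed

text \<open>Compare \<open>F = \<Prod>\<^sub>n\<^sub>\<le>\<^sub>X (n\<^sup>2 + 1)\<close> with the smaller number \<open>(X!)\<^sup>2\<close>, where \<open>X = 2Y\<close>. An odd prime in \<open>F\<close> has at most twice its
  multiplicity in \<open>X!\<close>, up to a factor \<open>(X\<^sup>2 + 1)\<^sup>2\<close>. The prime 2, however, occurs at most \<open>Y\<close> times in \<open>F\<close> (no
  \<open>n\<^sup>2 + 1\<close> is divisible by 4) but at least \<open>2Y\<close> times in \<open>(X!)\<^sup>2\<close>. The deficit \<open>2\<^sup>Y\<close> has to be
  made up by the error factors of the primes in \<open>Q\<close>. This Chebyshev-type count only gives about \<open>\<surd>Z / log Z\<close> primes up
  to \<open>Z\<close>, but any power of \<open>Z\<close> suffices for the application.\<close>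
lemma split_primes_lower_bound:
  fixes Y :: nat
  defines "X \<equiv> 2 * Y"
  defines "Q \<equiv> {p. prime p \<and> odd p \<and> (\<exists>n\<in>{1..X}. p dvd n\<^sup>2 + 1)}"
  shows "2 ^ Y \<le> (X\<^sup>2 + 1) ^ (2 * card Q)"
proof -
  define F :: nat where "F = (\<Prod>n=1..X. n\<^sup>2 + 1)"
  have F: "F > 0" by (simp add: F_def prod_pos)
  have dvdF: "p dvd F \<longleftrightarrow> (\<exists>n\<in>{1..X}. p dvd n\<^sup>2 + 1)" if "prime p" for p
    unfolding F_def using that by (subst prime_dvd_prod_iff) auto
  then have pf: "prime_factors F \<subseteq> insert 2 Q"
    using F by (auto simp: Q_def prime_factors_dvd) (metis primes_dvd_imp_eq two_is_prime_nat)
  have "Q \<subseteq> prime_factors F" using dvdF F by (auto simp: Q_def prime_factors_dvd)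
  then have fin: "finite Q" by (rule finite_subset) auto
  have Q: "prime p" "odd p" if "p \<in> Q" for p using that by (auto simp: Q_def)
  then have Q2: "2 \<notin> Q" by (metis even_numeral)
  define B where "B = (\<Prod>p\<in>Q. p ^ multiplicity p (fact X :: nat))"
  have B0: "B > 0" unfolding B_def using Q prime_gt_0_nat by (intro prod_pos) auto

  have two: "multiplicity 2 F \<le> Y"
  proof -
    have bd: "j \<le> 1" if "2 ^ j dvd n\<^sup>2 + 1" for n j :: nat
    proof (rule ccontr)
      assume "\<not> j \<le> 1"
      then have "(2::nat) ^ 2 dvd 2 ^ j" by (intro le_imp_power_dvd) auto
      then have "4 dvd n\<^sup>2 + 1" using that dvd_trans by fastforce
      then have "((n mod 4)\<^sup>2 + 1) mod 4 = 0"
        by (metis dvd_imp_mod_0 mod_add_left_eq power_mod)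
      moreover have "n mod 4 < 4" by simp
      then have "n mod 4 = 0 \<or> n mod 4 = 1 \<or> n mod 4 = 2 \<or> n mod 4 = 3" by linarith
      ultimately show False by (elim disjE) simp_all
    qed
    have "multiplicity 2 F = (\<Sum>j=1..1. card {n\<in>{1..X}. 2 ^ j dvd n\<^sup>2 + 1})"
      unfolding F_def using bd by (intro multiplicity_prod_eq_sum_card) auto
    also have "\<dots> = card {n\<in>{1..X}. odd n}" by simp
    also have "{n\<in>{1..X}. odd n} = (\<lambda>i. 2 * i + 1) ` {..<Y}"
      by (auto simp: X_def elim!: oddE)
    also have "card \<dots> \<le> Y" using card_image_le[of "{..<Y}"] by simp
    finally show ?thesis .
  qed
  have fact_ge: "2 ^ Y * B \<le> fact X"
  proof -
    have "Y \<le> multiplicity 2 (fact X :: nat)"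
      using multiplicity_fact_ge[where p = 2 and J = 1 and X = X] by (simp add: X_def)
    then have "2 ^ Y * B \<le> 2 ^ multiplicity 2 (fact X :: nat) * B"
      by (intro mult_right_mono power_increasing) auto
    also have "\<dots> = (\<Prod>p\<in>insert 2 Q. p ^ multiplicity p (fact X :: nat))"
      using fin Q2 by (simp add: B_def)
    also have "\<dots> dvd fact X"
      using fin Q by (intro prod_power_multiplicity_dvd) auto
    then have "(\<Prod>p\<in>insert 2 Q. p ^ multiplicity p (fact X :: nat)) \<le> fact X"
      by (rule dvd_imp_le) simp
    finally show ?thesis .
  qed
  have "(fact X)\<^sup>2 = (\<Prod>n=1..X. n\<^sup>2)"
    by (simp add: fact_prod prod_power_distrib)
  also have "\<dots> \<le> F" unfolding F_def by (intro prod_mono) auto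
  also have "F = (\<Prod>p\<in>prime_factors F. p ^ multiplicity p F)"
    using F by (simp add: prime_factorization_nat)
  also have "\<dots> = (\<Prod>p\<in>insert 2 Q. p ^ multiplicity p F)"
    using fin pf Q by (intro prod.mono_neutral_left) (auto simp: prime_factors_multiplicity)
  also have "\<dots> = 2 ^ multiplicity 2 F * (\<Prod>p\<in>Q. p ^ multiplicity p F)"
    using fin Q2 by simp
  also have "\<dots> \<le> 2 ^ Y * (\<Prod>p\<in>Q. (p ^ multiplicity p (fact X))\<^sup>2 * (X\<^sup>2 + 1)\<^sup>2)"
    using two Q power_multiplicity_le unfolding F_def
    by (intro mult_mono power_increasing prod_mono) auto
  also have "\<dots> = 2 ^ Y * (B\<^sup>2 * (X\<^sup>2 + 1) ^ (2 * card Q))"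
    by (simp add: prod.distrib B_def prod_power_distrib power_mult)
  finally have "(fact X)\<^sup>2 \<le> 2 ^ Y * (B\<^sup>2 * (X\<^sup>2 + 1) ^ (2 * card Q))" .
  moreover have "(2 ^ Y * B)\<^sup>2 \<le> (fact X)\<^sup>2" using fact_ge by (rule power_mono) simp
  ultimately have "(2 ^ Y * B)\<^sup>2 \<le> 2 ^ Y * (B\<^sup>2 * (X\<^sup>2 + 1) ^ (2 * card Q))"
    by linarith
  moreover have "(2 ^ Y * B)\<^sup>2 = (2 ^ Y * B\<^sup>2) * 2 ^ Y"
    by (simp add: power2_eq_square)
  ultimately have "(2 ^ Y * B\<^sup>2) * 2 ^ Y \<le> (2 ^ Y * B\<^sup>2) * (X\<^sup>2 + 1) ^ (2 * card Q)"
    by (simp only: mult.assoc)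
  then show ?thesis using B0 by (subst (asm) mult_le_cancel1) simp
qed

section \<open>Counting weighted pairs in two ways\<close>

lemma card_square_pairs_le:
  fixes X :: "nat set"
  assumes B: "Bh_set 2 g ((\<lambda>n. (int n)\<^sup>2) ` X)" and X: "finite X"
  shows "card {(x, y) \<in> X \<times> X. x\<^sup>2 + y\<^sup>2 = m} \<le> 2 * g"
proof -
  define A where "A = (\<lambda>n. (int n)\<^sup>2) ` X"
  define E where "E = {(x, y) \<in> X \<times> X. x\<^sup>2 + y\<^sup>2 = m \<and> x \<le> y}"
  define f where "f = (\<lambda>(x::nat, y::nat). [(int x)\<^sup>2, (int y)\<^sup>2])"
  have "finite (sum_reps A 2 (int m))" and g: "card (sum_reps A 2 (int m)) \<le> g"
    using B unfolding Bh_set_def sum_rep_count_def A_def by auto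
  moreover have "f ` E \<subseteq> sum_reps A 2 (int m)"
  proof
    fix xs assume "xs \<in> f ` E"
    then obtain x y where xs: "xs = [(int x)\<^sup>2, (int y)\<^sup>2]"
      and xy: "x \<in> X" "y \<in> X" "x\<^sup>2 + y\<^sup>2 = m" "x \<le> y"
      by (auto simp: E_def f_def)
    have "(int x)\<^sup>2 + (int y)\<^sup>2 = int m" unfolding xy(3)[symmetric] by simp
    moreover have "(int x)\<^sup>2 \<le> (int y)\<^sup>2" using xy(4) by (intro power_mono) auto
    moreover have "set xs \<subseteq> A" using xy by (simp add: xs A_def)
    ultimately show "xs \<in> sum_reps A 2 (int m)"
      unfolding sum_reps_def by (simp add: xs)
  qed
  moreover have "inj_on f E"
  proof -
    have "inj f" by (rule injI) (auto simp: f_def)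
    then show ?thesis by (rule inj_on_subset) simp
  qed
  ultimately have "card E \<le> card (sum_reps A 2 (int m))"
    by (intro card_inj_on_le)
  then have E: "card E \<le> g" using g by (rule le_trans)
  have fin: "finite E"
    by (rule finite_subset[of _ "X \<times> X"]) (use X in \<open>auto simp: E_def\<close>)
  have "{(x, y) \<in> X \<times> X. x\<^sup>2 + y\<^sup>2 = m} \<subseteq> E \<union> prod.swap ` E"
  proof
    fix z assume z: "z \<in> {(x, y) \<in> X \<times> X. x\<^sup>2 + y\<^sup>2 = m}"
    obtain x y where [simp]: "z = (x, y)" by (cases z)
    have "(x, y) \<in> E \<or> (y, x) \<in> E" using z by (auto simp: E_def add.commute)
    then show "z \<in> E \<union> prod.swap ` E" by force
  qed
  then have "card {(x, y) \<in> X \<times> X. x\<^sup>2 + y\<^sup>2 = m} \<le> card (E \<union> prod.swap ` E)"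
    using fin by (intro card_mono) auto
  also have "\<dots> \<le> card E + card (prod.swap ` E)" by (rule card_Un_le)
  also have "\<dots> \<le> g + g" using E card_image_le[OF fin, of prod.swap] by linarith
  finally show ?thesis by simp
qed

lemma sum_periodic_blocks:
  fixes W :: "nat \<Rightarrow> real"
  assumes "\<And>m. W (m mod q) = W m" "q > 0"
  shows "(\<Sum>m<L * q. W m) = real L * (\<Sum>m<q. W m)"
proof (induction L)
  case (Suc L)
  have "{..<Suc L * q} = {..<L * q} \<union> {L * q..<L * q + q}" by auto
  then have "(\<Sum>m<Suc L * q. W m) = (\<Sum>m\<in>{..<L * q} \<union> {L * q..<L * q + q}. W m)"
    by (rule arg_cong)
  also have "\<dots> = (\<Sum>m<L * q. W m) + (\<Sum>m=L * q..<L * q + q. W m)"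
    by (intro sum.union_disjoint) auto
  also have "(\<Sum>m=L * q..<L * q + q. W m) = (\<Sum>m<q. W (m + L * q))"
    using sum.shift_bounds_nat_ivl[of W 0 "L * q" q] by (simp add: lessThan_atLeast0 add.commute)
  also have "\<dots> = (\<Sum>m<q. W m)"
    by (intro sum.cong refl) (metis assms(1) mod_mult_self1)
  finally show ?case using Suc by (simp add: algebra_simps)
qed simp

text \<open>Each value \<open>m\<close> is attained by at most \<open>2 g\<close> ordered pairs, so the sum is at most \<open>2 g\<close> times the total
  weight of the integers up to \<open>2 N\<^sup>2\<close>. The weight is periodic modulo \<open>(\<Prod>P)\<^sup>2 \<le> N\<^sup>2\<close>, so complete periods up to
  \<open>3 N\<^sup>2\<close> cover this range.\<close>
lemma weighted_pairs_upper:
  fixes X :: "nat set"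
  assumes B: "Bh_set 2 g ((\<lambda>n. (int n)\<^sup>2) ` X)" and X: "X \<subseteq> {1..N}"
    and P: "finite P" "\<And>p. p \<in> P \<Longrightarrow> split_prime p" and M: "\<Prod>P \<le> N"
  shows "(\<Sum>x\<in>X. \<Sum>y\<in>X. \<Prod>p\<in>P. local_weight p (x\<^sup>2 + y\<^sup>2)) \<le> 6 * real g * (real N)\<^sup>2 * (4/5) ^ card P"
proof -
  have fin: "finite X" using X by (rule finite_subset) auto
  define W where "W m = (\<Prod>p\<in>P. local_weight p m)" for m
  define q where "q = (\<Prod>P)\<^sup>2"
  have M0: "\<Prod>P > 0" using P by (auto intro!: prod_pos prime_gt_0_nat simp: split_prime_def)
  then have q: "q > 0" by (simp add: q_def)
  have W0: "W m \<ge> 0" for m unfolding W_def by (intro prod_nonneg) (simp add: local_weight_nonneg)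
  have "p\<^sup>2 dvd q" if "p \<in> P" for p
    unfolding q_def using that P by (intro dvd_power_same dvd_prodI[where f="\<lambda>x. x", simplified]) auto
  then have Wq: "W (m mod q) = W m" for m
    unfolding W_def by (intro prod.cong refl local_weight_mod) auto
  define L where "L = 2 * N\<^sup>2 div q + 1"
  have L: "2 * N\<^sup>2 < L * q" 
    using q unfolding L_def by (metis add.commute dividend_less_times_div mult.commute mult_Suc_right plus_1_eq_Suc)
  have in_range: "x\<^sup>2 + y\<^sup>2 < L * q" if "x \<in> X" "y \<in> X" for x y
  proof -
    have "x\<^sup>2 \<le> N\<^sup>2" "y\<^sup>2 \<le> N\<^sup>2" using that X by (auto intro!: power_mono)
    then show ?thesis using L by linarith
  qed
  have reps: "real (card {(x, y) \<in> X \<times> X. x\<^sup>2 + y\<^sup>2 = m}) \<le> 2 * real g" for m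
    using of_nat_mono[OF card_square_pairs_le[OF B fin, of m], where ?'a = real] by simp
  have pairs: "{(x, y) \<in> X \<times> X. x\<^sup>2 + y\<^sup>2 = m} = {z \<in> X \<times> X. (fst z)\<^sup>2 + (snd z)\<^sup>2 = m}" for m
    by auto
  have "(\<Sum>x\<in>X. \<Sum>y\<in>X. W (x\<^sup>2 + y\<^sup>2)) = (\<Sum>z\<in>X \<times> X. W ((fst z)\<^sup>2 + (snd z)\<^sup>2))"
    by (simp add: sum.cartesian_product case_prod_beta)
  also have "\<dots> = (\<Sum>m<L * q. \<Sum>z\<in>{z \<in> X \<times> X. (fst z)\<^sup>2 + (snd z)\<^sup>2 = m}. W ((fst z)\<^sup>2 + (snd z)\<^sup>2))"
    using fin in_range by (intro sum.group[symmetric]) auto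
  also have "\<dots> = (\<Sum>m<L * q. real (card {(x, y) \<in> X \<times> X. x\<^sup>2 + y\<^sup>2 = m}) * W m)"
    unfolding pairs by simp
  also have "\<dots> \<le> (\<Sum>m<L * q. 2 * real g * W m)"
    by (intro sum_mono mult_right_mono reps W0)
  also have "\<dots> = 2 * real g * (real L * (\<Sum>m<q. W m))"
    by (simp only: sum_distrib_left[symmetric] sum_periodic_blocks[where W = W, OF Wq q])
  also have "\<dots> \<le> 2 * real g * (real L * (real q * (4/5) ^ card P))"
    using sum_prod_weight_le[OF P] by (intro mult_left_mono) (auto simp: W_def q_def)
  also have "\<dots> = 2 * real g * real (L * q) * (4/5) ^ card P" by simp
  also have "\<dots> \<le> 2 * real g * (3 * (real N)\<^sup>2) * (4/5) ^ card P"
  proof -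
    have "L * q \<le> 2 * N\<^sup>2 + q" unfolding L_def by (simp add: add_mult_distrib div_times_less_eq_dividend)
    also have "q \<le> N\<^sup>2" unfolding q_def using M by (rule power_mono) simp
    finally have "real (L * q) \<le> real (3 * N\<^sup>2)" unfolding of_nat_le_iff by linarith
    then show ?thesis by (intro mult_right_mono mult_left_mono) auto
  qed
  finally show ?thesis by (simp add: W_def)
qed

text \<open>Let \<open>f(u)\<close> be the number of elements of \<open>X\<close> in the residue class \<open>u\<close> modulo \<open>M = \<Prod>P\<close>. The spreading property bounds
  the weighted count of pairs from below by \<open>M\<^sup>-\<^sup>2 (\<Sum> \<surd>f)\<^sup>4\<close>. As \<open>M \<le> N\<close>, no class contains more than \<open>D = 2N / M\<close>
  elements, so \<open>\<surd>f \<ge> f / \<surd>D\<close> and the square-root sum is at least \<open>card X / \<surd>D\<close>.\<close>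
lemma weighted_pairs_lower:
  fixes X :: "nat set"
  assumes X: "X \<subseteq> {1..N}" and P: "finite P" "\<And>p. p \<in> P \<Longrightarrow> split_prime p" and M: "\<Prod>P \<le> N"
  shows "real (card X) ^ 4 \<le> 4 * (real N)\<^sup>2 * (\<Sum>x\<in>X. \<Sum>y\<in>X. \<Prod>p\<in>P. local_kernel p x y)"
proof -
  have fin: "finite X" using X by (rule finite_subset) auto
  define M where "M = \<Prod>P"
  have M0: "M > 0" unfolding M_def using P by (auto intro!: prod_pos prime_gt_0_nat simp: split_prime_def)
  have MN: "real M \<le> real N" using M unfolding M_def of_nat_le_iff .
  then have N0: "N > 0" using M0 by simp
  define K where "K x y = (\<Prod>p\<in>P. local_kernel p x y)" for x y
  have spr: "spreading M K" using spreading_prod_kernel[OF P] unfolding M_def K_def by simp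
  then have Kp: "K (x mod M) (y mod M) = K x y" for x y unfolding spreading_def by blast
  define f where "f u = real (card {x\<in>X. x mod M = u})" for u
  have group: "(\<Sum>x\<in>X. F (x mod M)) = (\<Sum>u<M. f u * F u)" for F :: "nat \<Rightarrow> real"
  proof -
    have "(\<Sum>x\<in>X. F (x mod M)) = (\<Sum>u<M. \<Sum>x\<in>{x\<in>X. x mod M = u}. F (x mod M))"
      using fin M0 by (intro sum.group[symmetric]) auto
    then show ?thesis by (simp add: f_def)
  qed
  have "(\<Sum>x\<in>X. \<Sum>y\<in>X. K x y) = (\<Sum>x\<in>X. \<Sum>y\<in>X. K (x mod M) (y mod M))" by (simp add: Kp)
  also have "\<dots> = (\<Sum>u<M. f u * (\<Sum>v<M. f v * K u v))"
    by (simp add: group[of "\<lambda>v. K _ v"] group[of "\<lambda>u. \<Sum>v<M. f v * K u v"])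
  finally have sumK: "(\<Sum>x\<in>X. \<Sum>y\<in>X. K x y) = (\<Sum>u<M. \<Sum>v<M. (sqrt (f u))\<^sup>2 * (sqrt (f v))\<^sup>2 * K u v)"
    by (simp add: f_def sum_distrib_left mult_ac)
  define D where "D = 2 * real N / real M"
  have D0: "D > 0" using N0 M0 by (simp add: D_def)
  have fD: "f u \<le> D" for u
  proof -
    have "card {x\<in>X. x mod M = u} \<le> card {n\<in>{1..N}. n mod M = u}" using X by (intro card_mono) auto
    also have "\<dots> \<le> N div M + 1" by (rule card_cong_class_le[OF M0])
    finally have "f u \<le> real (N div M) + 1" unfolding f_def by linarith
    also have "\<dots> \<le> real N / real M + real N / real M"
      using MN M0 by (intro add_mono of_nat_div_le_of_nat) simp
    finally show ?thesis by (simp add: D_def)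
  qed
  have "real (card X) = (\<Sum>u<M. f u)" using group[of "\<lambda>_. 1"] by simp
  also have "\<dots> \<le> (\<Sum>u<M. sqrt D * sqrt (f u))"
  proof (intro sum_mono)
    fix u
    have "f u = sqrt (f u) * sqrt (f u)" by (simp add: f_def)
    also have "\<dots> \<le> sqrt D * sqrt (f u)" using fD by (intro mult_right_mono) (auto simp: f_def)
    finally show "f u \<le> sqrt D * sqrt (f u)" .
  qed
  finally have "real (card X) \<le> sqrt D * (\<Sum>u<M. sqrt (f u))" by (simp add: sum_distrib_left)
  then have "real (card X) ^ 4 \<le> (sqrt D * (\<Sum>u<M. sqrt (f u))) ^ 4" by (rule power_mono) simp
  also have "\<dots> = D\<^sup>2 * ((\<Sum>u<M. sqrt (f u)) * (\<Sum>u<M. sqrt (f u)))\<^sup>2"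
    using D0 power_mult[of "sqrt D" 2 2] by (simp add: power_mult_distrib flip: power_add)
  also have "\<dots> \<le> D\<^sup>2 * ((real M)\<^sup>2 * (\<Sum>x\<in>X. \<Sum>y\<in>X. K x y))"
  proof (rule mult_left_mono)
    show "((\<Sum>u<M. sqrt (f u)) * (\<Sum>u<M. sqrt (f u)))\<^sup>2 \<le> (real M)\<^sup>2 * (\<Sum>x\<in>X. \<Sum>y\<in>X. K x y)"
      unfolding sumK using spr unfolding spreading_def by blast
  qed simp
  also have "\<dots> = 4 * (real N)\<^sup>2 * (\<Sum>x\<in>X. \<Sum>y\<in>X. K x y)"
    using M0 by (simp add: D_def power_divide power_mult_distrib)
  finally show ?thesis by (simp add: K_def)
qed

lemma Bh_set_squares_card_bound:
  fixes X :: "nat set"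
  assumes B: "Bh_set 2 g ((\<lambda>n. (int n)\<^sup>2) ` X)" and X: "X \<subseteq> {1..N}"
    and P: "finite P" "\<And>p. p \<in> P \<Longrightarrow> split_prime p" and M: "\<Prod>P \<le> N"
  shows "real (card X) ^ 4 \<le> 24 * real g * real N ^ 4 * (4/5) ^ card P"
proof -
  have "real (card X) ^ 4 \<le> 4 * (real N)\<^sup>2 * (\<Sum>x\<in>X. \<Sum>y\<in>X. \<Prod>p\<in>P. local_kernel p x y)"
    by (rule weighted_pairs_lower[OF X P M])
  also have "\<dots> \<le> 4 * (real N)\<^sup>2 * (\<Sum>x\<in>X. \<Sum>y\<in>X. \<Prod>p\<in>P. local_weight p (x\<^sup>2 + y\<^sup>2))"
    by (intro mult_left_mono sum_mono prod_mono conjI local_kernel_le_weight) (auto simp: local_kernel_def)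
  also have "\<dots> \<le> 4 * (real N)\<^sup>2 * (6 * real g * (real N)\<^sup>2 * (4/5) ^ card P)"
    by (intro mult_left_mono weighted_pairs_upper[OF B X P M]) auto
  finally show ?thesis by (simp add: power2_eq_square power4_eq_xxxx mult_ac)
qed

section \<open>Choice of the primes and conclusion\<close>

text \<open>With \<open>Y\<close> about \<open>L = ln N\<close>, the count of primes dividing some \<open>n\<^sup>2 + 1\<close>, \<open>n \<le> 2Y\<close>, provides at least
  \<open>Y ln 2 / (2 ln Z) \<ge> L / (10 ln L)\<close> primes up to \<open>Z = 4 Y\<^sup>2 + 1 \<le> L\<^sup>3\<close>, and any \<open>k \<le> L / (10 ln L)\<close>
  of them have product at most \<open>L\<^sup>3\<^sup>k \<le> N\<close>.\<close>
lemma many_split_primes: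
  fixes N k :: nat
  assumes N: "ln (real N) \<ge> 10" and k: "real k \<le> ln (real N) / (10 * ln (ln (real N)))"
  obtains P where "finite P" "card P = k" "\<And>p. p \<in> P \<Longrightarrow> split_prime p" "\<Prod>P \<le> N"
proof -
  define L where "L = ln (real N)"
  define Y where "Y = nat \<lfloor>L\<rfloor>"
  define Z where "Z = (2 * Y)\<^sup>2 + 1"
  define Q where "Q = {p. prime p \<and> odd p \<and> (\<exists>n\<in>{1..2 * Y}. p dvd n\<^sup>2 + 1)}"
  have L10: "L \<ge> 10" using N by (simp add: L_def)
  have N0: "N > 0" using N by (cases N) auto
  have lnL: "ln L > 0" using L10 by simp
  have Y: "real Y \<le> L" "real Y \<ge> L - 1" using L10 by (auto simp: Y_def)
  have "real Z = 4 * (real Y)\<^sup>2 + 1" by (simp add: Z_def power_mult_distrib)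
  also have "\<dots> \<le> 4 * L\<^sup>2 + 1" using Y by (simp add: power_mono)
  also have "\<dots> \<le> 8 * L\<^sup>2" using power_mono[OF L10, of 2] by simp
  also have "\<dots> \<le> L * L\<^sup>2" using L10 by (intro mult_right_mono) auto
  finally have Z: "real Z \<le> L ^ 3" by (simp add: power3_eq_cube power2_eq_square)
  have Z0: "real Z > 0" unfolding of_nat_0_less_iff by (simp add: Z_def)
  have lnZ: "ln (real Z) \<le> 3 * ln L"
  proof -
    have "ln (real Z) \<le> ln (L ^ 3)" using Z Z0 L10 by (intro ln_mono) auto
    also have "\<dots> = 3 * ln L" using L10 by (subst ln_realpow) auto
    finally show ?thesis .
  qed
  have pl: "p \<le> Z" if p: "p \<in> Q" for p
  proof -
    obtain n where n: "n \<le> 2 * Y" "p dvd n\<^sup>2 + 1" using p by (auto simp: Q_def)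
    then have "p \<le> n\<^sup>2 + 1" by (intro dvd_imp_le) auto
    also have "\<dots> \<le> Z" unfolding Z_def by (intro add_mono power_mono n(1)) auto
    finally show ?thesis .
  qed
  have "2 ^ Y \<le> Z ^ (2 * card Q)"
    unfolding Z_def Q_def by (rule split_primes_lower_bound)
  then have "real (2 ^ Y) \<le> real (Z ^ (2 * card Q))" by (rule of_nat_mono)
  then have "ln (2 ^ Y) \<le> ln (real Z ^ (2 * card Q))"
    using Z0 by (intro ln_mono) auto
  then have "real Y * ln 2 \<le> real (2 * card Q) * ln (real Z)"
    using Z0 by (simp add: ln_realpow)
  also have "\<dots> \<le> real (2 * card Q) * (3 * ln L)" by (intro mult_left_mono lnZ) auto
  finally have "real Y * ln 2 \<le> 6 * (real (card Q) * ln L)" by simp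
  moreover have "L / 10 * 6 \<le> real Y * ln 2"
  proof -
    have "L / 10 * 6 \<le> (L - 1) * (2 / 3)" using L10 by simp
    also have "\<dots> \<le> real Y * ln 2"
      using Y L10 ln2_ge_two_thirds by (intro mult_mono) auto
    finally show ?thesis .
  qed
  moreover have "real k * ln L \<le> L / 10" using k lnL by (simp add: L_def field_simps)
  ultimately have "real k * ln L \<le> real (card Q) * ln L" by linarith
  then have "k \<le> card Q" using lnL by simp
  then obtain P where P: "P \<subseteq> Q" "card P = k" "finite P"
    by (metis obtain_subset_with_card_n)
  have "\<Prod>P \<le> Z ^ card P"
    using prod_mono[of P "\<lambda>p. p" "\<lambda>_. Z"] pl P by auto
  then have "real (\<Prod>P) \<le> real Z ^ k" using P by (metis of_nat_le_iff of_nat_power)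
  also have "\<dots> = exp (real k * ln (real Z))" using Z0 by (simp add: exp_of_nat_mult)
  also have "\<dots> \<le> exp (real k * (3 * ln L))" using lnZ by (simp add: mult_left_mono)
  also have "\<dots> \<le> exp L" using \<open>real k * ln L \<le> L / 10\<close> L10 by simp
  also have "\<dots> = real N" using N0 by (simp add: L_def)
  finally have "\<Prod>P \<le> N" by (simp only: of_nat_le_iff)
  then show ?thesis using that[of P] P by (auto simp: Q_def split_prime_def)
qed

theorem theorem1p6:
  "\<exists>c::real. c > 0 \<and> (\<exists>C::real. C > 0 \<and>
     (\<forall>(N::nat) (g::nat) (A::int set).
        N \<ge> 3 \<longrightarrow> g \<ge> 1 \<longrightarrow> A \<subseteq> {(int n)^2 | n. n \<in> {1..N}} \<longrightarrow> Bh_set 2 g A \<longrightarrow>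
        real (card A) \<le> C * (real g powr (1/4) * real N * exp (- c * (ln (real N) / ln (ln (real N)))))))"
proof -
  \<comment> \<open>As \<open>(4/5)\<^sup>k \<le> exp (- k/5)\<close> with \<open>k\<close> about \<open>ln N / (10 ln (ln N))\<close>, the fourth root gives \<open>c = 1/200\<close>.\<close>
  define c :: real where "c = 1/200"
  define C :: real where "C = max 3 (exp (c * (10 / ln (ln 3))))"
  \<comment> \<open>This makes \<open>ln (ln N)\<close> positive for \<open>N \<ge> 3\<close>; it follows from \<open>2\<^sup>1\<^sup>2 < 3\<^sup>8\<close> and \<open>ln 2 \<ge> 2/3\<close>.\<close>
  have ln3: "ln 3 > (1::real)"
  proof -
    have "12 * ln 2 = ln (4096::real)" using ln_realpow[of "2::real" 12] by simp
    also have "\<dots> < ln 6561" by simp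
    also have "\<dots> = 8 * ln (3::real)" using ln_realpow[of "3::real" 8] by simp
    finally show ?thesis using ln2_ge_two_thirds by simp
  qed
  have "real (card A) \<le> C * (real g powr (1/4) * real N * exp (- c * (ln (real N) / ln (ln (real N)))))"
    if N: "N \<ge> 3" and g: "g \<ge> 1" and A: "A \<subseteq> {(int n)^2 | n. n \<in> {1..N}}" and B: "Bh_set 2 g A"
    for N g :: nat and A :: "int set"
  proof -
    define L where "L = ln (real N)"
    have L3: "L \<ge> ln 3" using N by (simp add: L_def)
    have lnL: "ln L \<ge> ln (ln 3)" "ln (ln 3 :: real) > 0" using L3 ln3 by auto
    define X where "X = {n\<in>{1..N}. (int n)\<^sup>2 \<in> A}"
    have AX: "A = (\<lambda>n. (int n)\<^sup>2) ` X" using A by (auto simp: X_def)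
    have XN: "X \<subseteq> {1..N}" by (auto simp: X_def)
    have "inj_on (\<lambda>n. (int n)\<^sup>2) X" by (rule inj_onI) auto
    then have card: "card A = card X" unfolding AX by (rule card_image)
    show ?thesis
    proof (cases "L \<ge> 10")
      case False
      \<comment> \<open>For bounded \<open>N\<close> the claim follows from \<open>card A \<le> N\<close>, as \<open>C\<close> absorbs the exponential.\<close>
      have "L / ln L \<le> 10 / ln (ln 3)" using False lnL by (intro frac_le) auto
      then have "exp (c * (L / ln L)) \<le> exp (c * (10 / ln (ln 3)))"
        by (simp only: exp_le_cancel_iff) (intro mult_left_mono, auto simp: c_def)
      then have "exp (c * (L / ln L)) \<le> C"
        unfolding C_def by (rule max.coboundedI2)
      then have "1 \<le> C * exp (- c * (L / ln L))" by (simp add: exp_minus field_simps)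
      moreover have "1 \<le> real g powr (1/4)" using g by (intro ge_one_powr_ge_zero) auto
      ultimately have "1 * 1 \<le> real g powr (1/4) * (C * exp (- c * (L / ln L)))"
        by (intro mult_mono) auto
      then have "real N * 1 \<le> real N * (real g powr (1/4) * (C * exp (- c * (L / ln L))))"
        by (intro mult_left_mono) auto
      moreover have "real (card A) \<le> real N"
        using card_mono[OF _ XN] by (simp add: card)
      ultimately show ?thesis by (simp add: L_def mult_ac)
    next
      case True
      define T where "T = L / (10 * ln L)"
      define k where "k = nat \<lfloor>T\<rfloor>"
      have T0: "T \<ge> 0" using lnL True by (simp add: T_def)
      then have k: "real k \<le> T" "real k \<ge> T - 1" by (auto simp: k_def)
      obtain P where P: "finite P" "card P = k" "\<And>p. p \<in> P \<Longrightarrow> split_prime p" "\<Prod>P \<le> N"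
        using many_split_primes[of N k] True k(1) unfolding L_def T_def by blast
      have "(4/5 :: real) \<le> exp (- (1/5))" using exp_ge_add_one_self[of "- (1/5)"] by simp
      then have "(4/5 :: real) ^ k \<le> exp (- (1/5)) ^ k" by (rule power_mono) simp
      also have "\<dots> = exp (- (real k / 5))" by (simp flip: exp_of_nat_mult)
      also have "\<dots> \<le> exp (1/5 - T / 5)" using k(2) by simp
      also have "\<dots> = exp (1/5) * exp (- (T / 20)) ^ 4"
        by (simp flip: exp_of_nat_mult exp_add)
      finally have 45: "(4/5 :: real) ^ k \<le> exp (1/5) * exp (- (T / 20)) ^ 4" .
      \<comment> \<open>The factor \<open>exp (1/5)\<close> pays for rounding \<open>T\<close> down to \<open>k\<close>; \<open>81 = 3\<^sup>4\<close> explains the 3 in \<open>C\<close>.\<close>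
      have e: "24 * exp (1/5) \<le> (81::real)"
      proof -
        have "exp (1/5) \<le> exp (1::real)" by simp
        then show ?thesis using exp_le by linarith
      qed
      have "real (card X) ^ 4 \<le> 24 * real g * real N ^ 4 * (4/5) ^ k"
        using Bh_set_squares_card_bound[of g X N P] B P XN AX by auto
      also have "\<dots> \<le> 24 * real g * real N ^ 4 * (exp (1/5) * exp (- (T / 20)) ^ 4)"
        by (intro mult_left_mono 45) auto
      also have "\<dots> = (24 * exp (1/5)) * (real g * real N ^ 4 * exp (- (T / 20)) ^ 4)" by simp
      also have "\<dots> \<le> 3 ^ 4 * (real g * real N ^ 4 * exp (- (T / 20)) ^ 4)"
        using e by (intro mult_right_mono) auto
      also have "real g = (real g powr (1/4)) ^ 4"
        using g by (simp flip: powr_realpow add: powr_powr)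
      finally have "real (card X) ^ 4 \<le> (3 * (real g powr (1/4) * real N * exp (- (T / 20)))) ^ 4"
        by (simp add: power_mult_distrib)
      then have "real (card X) \<le> 3 * (real g powr (1/4) * real N * exp (- (T / 20)))"
        by (rule power_le_imp_le_base[of _ 3, simplified]) auto
      also have "\<dots> \<le> C * (real g powr (1/4) * real N * exp (- (T / 20)))"
        by (intro mult_right_mono) (auto simp: C_def)
      finally show ?thesis by (simp add: card c_def T_def L_def)
    qed
  qed
  moreover have "c > 0" "C > 0" by (auto simp: c_def C_def)
  ultimately show ?thesis by blast
qed

end
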